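(* Let $S$ be an HL semigroup and let $u\in 0^+(S)$ satisfy $u=u+u$. Then for every $C\in D(u\otimes u)$ there exist sequences $\langle x_n\rangle_{n=1}^\infty$ and $\langle y_n\rangle_{n=1}^\infty$ of positive real numbers such that (1) $FS(\langle x_n\rangle_{n=1}^\infty)\cup\left\{\frac{\sum_{n\in G}x_n}{\sum_{n\in F}x_n}: F,G\in\mathcal P_f(\mathbb N),\ F<G\right\}\subseteq C$, and (2) $\left\{\sum_{l\in F}\prod_{n=k}^{l}y_n: F\in\mathcal P_f(\mathbb N),\ k\le\min F\right\}\subseteq C$.
   Context: A dense subsemigroup $S$ of $((0,\infty),+)$ is called an HL semigroup if $S\cap(0,1)$ is a subsemigroup of $((0,1),\cdot)$ and for each $y\in S\cap(0,1)$ and each $x\in S$, both $x/y\in S$ and $yx\in S$. $\beta S$ is the set of ultrafilters on the discrete set $S$, with the operation $+$ extending addition of $S$: for $p,q\in\beta S$ and $A\subseteq S$, $A\in p+q$ iff $\{x\in S: -x+A\in q\}\in p$, where $-x+A=\{y\in S: x+y\in A\}$. $0^+(S)=\{p\in\beta S: S\cap(0,\epsilon)\in p \text{ for all } \epsilon>0\}$. For $p,q\in\beta S$, $p\otimes q=\{A\subseteq S\times S: \{x\in S: \{y\in S:(x,y)\in A\}\in q\}\in p\}$. Fix $s_0\in S$ and define $D:S\times S\to S$ by $D(x,y)=y/x$ if $x\in S\cap(0,1)$ and $D(x,y)=s_0$ otherwise; for an ultrafilter $w$ on $S\times S$, $D(w)=\{B\subseteq S: D^{-1}[B]\in w\}$.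 $\mathcal P_f(\mathbb N)$ is the set of finite nonempty subsets of $\mathbb N$; for $F,G\in\mathcal P_f(\mathbb N)$, $F<G$ means $\max F<\min G$. $FS(\langle x_n\rangle_{n=1}^\infty)=\{\sum_{n\in F}x_n: F\in\mathcal P_f(\mathbb N)\}$. *)

theory Defs
  imports "HOL-Analysis.Elementary_Topology"
begin

definition HL_semigroup :: "real set \<Rightarrow> bool" where
  "HL_semigroup S \<longleftrightarrow>
     S \<subseteq> {0<..} \<and> {0<..} \<subseteq> closure S \<and>
     (\<forall>x\<in>S. \<forall>y\<in>S. x + y \<in> S) \<and>
     (\<forall>x\<in>S \<inter> {0<..<1}. \<forall>y\<in>S \<inter> {0<..<1}. x * y \<in> S \<inter> {0<..<1}) \<and>
     (\<forall>y\<in>S \<inter> {0<..<1}. \<forall>x\<in>S. x / y \<in> S \<and> y * x \<in> S)"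

text \<open>Filters and ultrafilters on a carrier set \<open>X\<close> are sets of subsets of \<open>X\<close>; an ultrafilter
  is a filter not properly contained in another filter.\<close>

definition set_filter :: "'a set \<Rightarrow> 'a set set \<Rightarrow> bool" where
  "set_filter X U \<longleftrightarrow>
     U \<subseteq> Pow X \<and> U \<noteq> {} \<and> {} \<notin> U \<and>
     (\<forall>A\<in>U. \<forall>B\<in>U. A \<inter> B \<in> U) \<and>
     (\<forall>A\<in>U. \<forall>B. A \<subseteq> B \<and> B \<subseteq> X \<longrightarrow> B \<in> U)"

definition set_ultrafilter :: "'a set \<Rightarrow> 'a set set \<Rightarrow> bool" where
  "set_ultrafilter X U \<longleftrightarrow>
     set_filter X U \<and> (\<forall>V. set_filter X V \<and> U \<subseteq> V \<longrightarrow> V = U)"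

definition beta :: "'a set \<Rightarrow> 'a set set set" where
  "beta S = {p. set_ultrafilter S p}"

definition beta_plus :: "real set \<Rightarrow> real set set \<Rightarrow> real set set \<Rightarrow> real set set" where
  "beta_plus S p q = {A. A \<subseteq> S \<and> {x \<in> S. {y \<in> S. x + y \<in> A} \<in> q} \<in> p}"

definition zero_plus :: "real set \<Rightarrow> real set set set" where
  "zero_plus S = {p \<in> beta S. \<forall>\<epsilon>>0. S \<inter> {0<..<\<epsilon>} \<in> p}"

definition ultra_tensor :: "'a set \<Rightarrow> 'a set set \<Rightarrow> 'a set set \<Rightarrow> ('a \<times> 'a) set set" where
  "ultra_tensor S p q = {A. A \<subseteq> S \<times> S \<and> {x \<in> S. {y \<in> S. (x, y) \<in> A} \<in> q} \<in> p}"

definition D_map :: "real set \<Rightarrow> real \<Rightarrow> real \<times> real \<Rightarrow> real" where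
  "D_map S s0 = (\<lambda>(x, y). if x \<in> S \<inter> {0<..<1} then y / x else s0)"

definition D_ultra :: "real set \<Rightarrow> real \<Rightarrow> (real \<times> real) set set \<Rightarrow> real set set" where
  "D_ultra S s0 w = {B. B \<subseteq> S \<and> {z \<in> S \<times> S. D_map S s0 z \<in> B} \<in> w}"

text \<open>The natural numbers start at 1 here, so sequences are functions on \<open>nat\<close> whose value at 0
  is irrelevant.\<close>

definition Pf :: "nat set set" where
  "Pf = {F. finite F \<and> F \<noteq> {} \<and> F \<subseteq> {1..}}"

definition set_less :: "nat set \<Rightarrow> nat set \<Rightarrow> bool" where
  "set_less F G \<longleftrightarrow> Max F < Min G"

definition FS :: "(nat \<Rightarrow> real) \<Rightarrow> real set" where
  "FS x = {\<Sum>n\<in>F. x n | F. F \<in> Pf}"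

end

theory Submission
  imports Defs
begin

text \<open>
  Let \<open>E\<close> be the set of \<open>x \<in> S \<inter> (0,1)\<close> for which \<open>{y \<in> S. y / x \<in> C}\<close> belongs to \<open>u\<close>; the
  hypothesis on \<open>C\<close> says that \<open>E \<in> u\<close>. Since \<open>u\<close> is idempotent, a Galvin--Glazer construction gives
  \<open>z\<^sub>0, z\<^sub>1, \<dots>\<close> with all finite sums in \<open>E\<close> and with \<open>(\<Sum>n\<in>G. z\<^sub>n) / (\<Sum>n\<in>F. z\<^sub>n) \<in> C\<close> whenever \<open>F < G\<close>.
  Then \<open>x\<^sub>n = z\<^sub>n / z\<^sub>0\<close> and \<open>y\<^sub>n = z\<^sub>n / z\<^sub>n\<^sub>-\<^sub>1\<close> work: dividing by \<open>z\<^sub>0\<close> leaves quotients unchanged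
  and turns sums into quotients, and \<open>y\<^sub>k \<cdots> y\<^sub>l\<close> telescopes to \<open>z\<^sub>l / z\<^sub>k\<^sub>-\<^sub>1\<close>.
\<close>

lemma set_filter_Int_finite_Inter:
  assumes u: "set_filter X u" and "finite T" and "\<And>t. t \<in> T \<Longrightarrow> B t \<in> u" and "A \<in> u"
  shows "A \<inter> (\<Inter>t\<in>T. B t) \<in> u"
  using assms(2-)
proof (induction T rule: finite_induct)
  case empty
  then show ?case by simp
next
  case (insert t T)
  then have "A \<inter> (\<Inter>t\<in>T. B t) \<in> u" and "B t \<in> u"
    by auto
  then have "(A \<inter> (\<Inter>t\<in>T. B t)) \<inter> B t \<in> u"
    using u unfolding set_filter_def by blast
  moreover have "(A \<inter> (\<Inter>t\<in>T. B t)) \<inter> B t = A \<inter> (\<Inter>t\<in>insert t T. B t)"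
    by auto
  ultimately show ?case by simp
qed

text \<open>Idempotence puts the set of \<open>x\<close> whose translate of \<open>A\<close> is
  large into \<open>u\<close>, so it meets \<open>A\<close>.\<close>

lemma idempotent_filter_obtain_shift:
  assumes u: "set_filter S u" and idem: "u = beta_plus S u u" and A: "A \<in> u"
  obtains z where "z \<in> A" and "{y \<in> S. z + y \<in> A} \<in> u"
proof -
  have "A \<in> beta_plus S u u"
    using equalityD1[OF idem] A by (rule subsetD)
  then have "{x \<in> S. {y \<in> S. x + y \<in> A} \<in> u} \<in> u"
    unfolding beta_plus_def by simp
  then have "A \<inter> {x \<in> S. {y \<in> S. x + y \<in> A} \<in> u} \<in> u"
    using u A unfolding set_filter_def by blast
  moreover have "{} \<notin> u"
    using u unfolding set_filter_def by blast
  ultimately have "A \<inter> {x \<in> S. {y \<in> S. x + y \<in> A} \<in> u} \<noteq> {}"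
    by metis
  then show thesis
    using that by blast
qed

text \<open>Split off the smallest index \<open>k\<close>: the remaining sum starts at
  \<open>Suc k\<close> or later, so it lies in \<open>A (Suc k)\<close>, and adding
  \<open>z k\<close> moves it into \<open>A k\<close>.\<close>

lemma sum_mem_shift_chain:
  fixes z :: "nat \<Rightarrow> 'a::comm_monoid_add"
  assumes mem: "\<And>n. z n \<in> A n" and anti: "\<And>n. A (Suc n) \<subseteq> A n"
    and shift: "\<And>n y. y \<in> A (Suc n) \<Longrightarrow> z n + y \<in> A n"
  shows "finite F \<Longrightarrow> F \<noteq> {} \<Longrightarrow> m \<le> Min F \<Longrightarrow> sum z F \<in> A m"
proof (induction "card F" arbitrary: F m rule: less_induct)
  case less
  have "decseq A"
    by (simp add: anti decseq_Suc_iff)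
  define k where "k = Min F"
  have kF: "k \<in> F"
    using less.prems by (simp add: k_def)
  have "sum z F \<in> A k"
  proof (cases "F = {k}")
    case True
    then show ?thesis using mem by simp
  next
    case False
    define G where "G = F - {k}"
    have G: "finite G" "G \<noteq> {}"
      using False kF less.prems by (auto simp: G_def)
    have "card G < card F"
      unfolding G_def using kF less.prems by (intro card_Diff1_less) auto
    moreover have "Suc k \<le> Min G"
    proof -
      have "Min G \<in> G"
        using G by simp
      then have "k \<le> Min G" "Min G \<noteq> k"
        using less.prems by (auto simp: G_def k_def)
      then show ?thesis by simp
    qed
    ultimately have "sum z G \<in> A (Suc k)"
      using less.hyps G by blast
    then have "z k + sum z G \<in> A k"
      by (rule shift)
    moreover have "sum z F = z k + sum z G"
      unfolding G_def using kF less.prems by (intro sum.remove) auto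
    ultimately show ?thesis by simp
  qed
  moreover have "A k \<subseteq> A m"
    using less.prems(3) \<open>decseq A\<close> unfolding k_def by (simp only: decseq_def)
  ultimately show ?case by blast
qed

text \<open>At each stage only finitely many sums \<open>t\<close> have been formed, so intersecting
  with all their sets \<open>B t\<close> keeps the next set in \<open>u\<close>.\<close>

lemma idempotent_filter_sum_sequence:
  assumes u: "set_filter S u" and idem: "u = beta_plus S u u"
    and E: "E \<in> u" and B: "\<And>x. x \<in> E \<Longrightarrow> B x \<in> u"
  obtains z :: "nat \<Rightarrow> real"
  where "\<forall>F. finite F \<and> F \<noteq> {} \<longrightarrow> sum z F \<in> E"
    and "\<forall>F G. finite F \<and> F \<noteq> {} \<and> finite G \<and> G \<noteq> {} \<and> Max F < Min G \<longrightarrow>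
           sum z G \<in> B (sum z F)"
proof -
  \<comment> \<open>A state consists of the current term \<open>z\<close>, the set \<open>A \<in> u\<close> that has to contain all
    sums starting from this stage, and the set \<open>T\<close> of the sums of all sets of terms so far
    (including the empty sum).\<close>
  define P :: "nat \<Rightarrow> real \<times> real set \<times> real set \<Rightarrow> bool"
    where "P = (\<lambda>_ (z, A, T). A \<in> u \<and> A \<subseteq> E \<and> z \<in> A \<and> {y \<in> S. z + y \<in> A} \<in> u \<and> finite T)"
  \<comment> \<open>The restriction to \<open>T \<inter> E\<close> is there because
    \<open>B t\<close> is known to be large only for \<open>t\<close> in \<open>E\<close>, while
    \<open>T\<close> also holds the empty sum 0.\<close>
  define Q :: "nat \<Rightarrow> real \<times> real set \<times> real set \<Rightarrow> real \<times> real set \<times> real set \<Rightarrow> bool"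
    where "Q = (\<lambda>_ (z, A, T) (z', A', T'). A' \<subseteq> A \<and> (\<forall>y\<in>A'. z + y \<in> A) \<and>
      (\<forall>t\<in>T \<inter> E. A' \<subseteq> B t) \<and> T \<subseteq> T' \<and> (\<forall>t\<in>T. z' + t \<in> T'))"
  have start: "\<exists>s. P 0 s \<and> {0, fst s} \<subseteq> snd (snd s)"
  proof -
    obtain z where "z \<in> E" "{y \<in> S. z + y \<in> E} \<in> u"
      using idempotent_filter_obtain_shift[OF u idem E] .
    then have "P 0 (z, E, {0, z})"
      using E by (simp add: P_def)
    then show ?thesis by fastforce
  qed
  then obtain s0 where s0: "P 0 s0" "{0, fst s0} \<subseteq> snd (snd s0)"
    by blast
  have step: "\<exists>s'. P (Suc n) s' \<and> Q n s s'" if "P n s" for n s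
  proof -
    obtain z A T where s: "s = (z, A, T)"
      by (cases s)
    have A: "A \<in> u" "A \<subseteq> E" "{y \<in> S. z + y \<in> A} \<in> u" "finite T"
      using that by (auto simp: s P_def)
    define A' where "A' = (A \<inter> {y \<in> S. z + y \<in> A}) \<inter> (\<Inter>t\<in>T \<inter> E. B t)"
    have "A \<inter> {y \<in> S. z + y \<in> A} \<in> u"
      using u A unfolding set_filter_def by blast
    then have "A' \<in> u"
      unfolding A'_def using u A(4) B by (intro set_filter_Int_finite_Inter) auto
    then obtain z' where "z' \<in> A'" "{y \<in> S. z' + y \<in> A'} \<in> u"
      using idempotent_filter_obtain_shift[OF u idem] by blast
    then have "P (Suc n) (z', A', T \<union> (+) z' ` T)"
      using A \<open>A' \<in> u\<close> by (auto simp: P_def A'_def)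
    moreover have "Q n s (z', A', T \<union> (+) z' ` T)"
      by (auto simp: Q_def s A'_def)
    ultimately show ?thesis by blast
  qed
  obtain f where f: "f 0 = s0" "\<And>n. P n (f n)" "\<And>n. Q n (f n) (f (Suc n))"
  proof -
    \<comment> \<open>The clause for \<open>n = 0\<close> pins the initial state, since
      \<open>P\<close> does not say which sums \<open>T\<close> contains.\<close>
    have "\<exists>f. \<forall>n. (P n (f n) \<and> (n = 0 \<longrightarrow> f n = s0)) \<and> Q n (f n) (f (Suc n))"
    proof (rule dependent_nat_choice)
      show "\<exists>s. P 0 s \<and> (0 = (0::nat) \<longrightarrow> s = s0)"
        using s0(1) by blast
    qed (use step in blast)
    then show thesis using that by blast
  qed
  define z where "z n = fst (f n)" for n
  define A where "A n = fst (snd (f n))" for n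
  define T where "T n = snd (snd (f n))" for n
  have feq: "f n = (z n, A n, T n)" for n
    by (simp add: z_def A_def T_def)
  have AE: "A n \<subseteq> E" and zA: "z n \<in> A n" for n
    using f(2)[of n] by (auto simp: P_def feq)
  have anti: "A (Suc n) \<subseteq> A n" and shift: "y \<in> A (Suc n) \<Longrightarrow> z n + y \<in> A n"
    and AB: "t \<in> T n \<Longrightarrow> t \<in> E \<Longrightarrow> A (Suc n) \<subseteq> B t"
    and TSuc: "T n \<subseteq> T (Suc n)" "t \<in> T n \<Longrightarrow> z (Suc n) + t \<in> T (Suc n)" for n y t
    using f(3)[of n] by (auto simp: Q_def feq)
  have T0: "0 \<in> T 0" "z 0 \<in> T 0"
    using s0(2) f(1) by (auto simp: T_def z_def)
  have sumT: "F \<subseteq> {..n} \<Longrightarrow> sum z F \<in> T n" for F n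
  proof (induction n arbitrary: F)
    case 0
    then have "F = {} \<or> F = {0}" by auto
    then show ?case using T0 by auto
  next
    case (Suc n)
    have fin: "finite F"
      using Suc.prems finite_subset by blast
    have "F - {Suc n} \<subseteq> {..n}"
      using Suc.prems by (auto simp: atMost_Suc)
    then have IH: "sum z (F - {Suc n}) \<in> T n"
      by (rule Suc.IH)
    show ?case
    proof (cases "Suc n \<in> F")
      case True
      then show ?thesis
        using TSuc(2)[OF IH] sum.remove[OF fin True, of z] by simp
    next
      case False
      then show ?thesis
        using IH TSuc(1) by auto
    qed
  qed
  have sumA: "sum z F \<in> A m" if "finite F" "F \<noteq> {}" "m \<le> Min F" for F m
    using sum_mem_shift_chain[of z A, OF zA anti shift that] .
  have sumE: "sum z F \<in> E" if "finite F" "F \<noteq> {}" for F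
    using sumA[OF that, of 0] AE by auto
  have "sum z G \<in> B (sum z F)"
    if "finite F" "F \<noteq> {}" "finite G" "G \<noteq> {}" "Max F < Min G" for F G
  proof -
    \<comment> \<open>Sums formed up to stage \<open>Max F\<close> constrain the sets from stage
      \<open>Suc (Max F)\<close> on, which is where \<open>G\<close> may begin.\<close>
    have "sum z F \<in> T (Max F)"
      using that(1) by (intro sumT) auto
    then have "A (Suc (Max F)) \<subseteq> B (sum z F)"
      using AB sumE that(1,2) by blast
    moreover have "sum z G \<in> A (Suc (Max F))"
      using that by (intro sumA) (simp_all del: Min_gr_iff Max_less_iff Min_ge_iff)
    ultimately show ?thesis by blast
  qed
  with sumE show thesis
    by (intro that[of z] allI impI) blast+
qed

text \<open>The product telescopes: each new factor cancels the numerator \<open>z l\<close>, which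
  is nonzero.\<close>

lemma prod_consecutive_quotients:
  fixes z :: "nat \<Rightarrow> 'a::field"
  assumes nz: "\<And>n. z n \<noteq> 0" and "1 \<le> k" and "k \<le> l"
  shows "(\<Prod>n=k..l. z n / z (n - 1)) = z l / z (k - 1)"
  using \<open>k \<le> l\<close>
proof (induction l rule: dec_induct)
  case base
  then show ?case by simp
next
  case (step l)
  then show ?case
    using nz[of l] by (simp add: prod.nat_ivl_Suc')
qed

theorem theorem4p5:
  fixes S :: "real set" and s0 :: real and u :: "real set set" and C :: "real set"
  assumes "HL_semigroup S"
    and "s0 \<in> S"
    and "u \<in> zero_plus S"
    and "u = beta_plus S u u"
    and "C \<in> D_ultra S s0 (ultra_tensor S u u)"
  shows "\<exists>x y :: nat \<Rightarrow> real.
      (\<forall>n\<ge>1. x n > 0) \<and> (\<forall>n\<ge>1. y n > 0) \<and>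
      FS x \<union> {(\<Sum>n\<in>G. x n) / (\<Sum>n\<in>F. x n) | F G. F \<in> Pf \<and> G \<in> Pf \<and> set_less F G} \<subseteq> C \<and>
      {\<Sum>l\<in>F. \<Prod>n=k..l. y n | F k. F \<in> Pf \<and> 1 \<le> k \<and> k \<le> Min F} \<subseteq> C"
proof -
  have u: "set_filter S u" and small: "S \<inter> {0<..<1} \<in> u"
    using assms(3) by (auto simp: zero_plus_def beta_def set_ultrafilter_def)
  define W where "W = {x \<in> S. {y \<in> S. D_map S s0 (x, y) \<in> C} \<in> u}"
  \<comment> \<open>Inside (0,1) \<open>D_map\<close> is the true quotient, so the default value
    \<open>s0\<close> never interferes.\<close>
  define E where "E = S \<inter> {0<..<1} \<inter> W"
  have "{x \<in> S. {y \<in> S. (x, y) \<in> {z \<in> S \<times> S. D_map S s0 z \<in> C}} \<in> u} \<in> u"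
    using assms(5) by (simp add: D_ultra_def ultra_tensor_def)
  also have "{x \<in> S. {y \<in> S. (x, y) \<in> {z \<in> S \<times> S. D_map S s0 z \<in> C}} \<in> u} = W"
    unfolding W_def by (intro Collect_cong conj_cong refl) simp
  finally have "E \<in> u"
    using u small unfolding E_def set_filter_def by blast
  have quot_mem: "{y \<in> S. y / x \<in> C} \<in> u" if "x \<in> E" for x
    using that by (auto simp: E_def W_def D_map_def)
  obtain z :: "nat \<Rightarrow> real"
    where sumE: "\<forall>F. finite F \<and> F \<noteq> {} \<longrightarrow> sum z F \<in> E"
      and quot: "\<forall>F G. finite F \<and> F \<noteq> {} \<and> finite G \<and> G \<noteq> {} \<and> Max F < Min G \<longrightarrow>
           sum z G \<in> {y \<in> S. y / sum z F \<in> C}"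
    using idempotent_filter_sum_sequence
      [OF u assms(4) \<open>E \<in> u\<close>, where B = "\<lambda>x. {y \<in> S. y / x \<in> C}", OF quot_mem] .
  have pos: "z n > 0" for n
    using sumE[rule_format, of "{n}"] by (simp add: E_def)
  have nz: "z n \<noteq> 0" for n
    using pos[of n] by simp
  have quotC: "sum z G / sum z F \<in> C"
    if "finite F" "F \<noteq> {}" "finite G" "G \<noteq> {}" "Max F < Min G" for F G
    using quot that by blast
  \<comment> \<open>Single-term denominators suffice for two of the three inclusions:
    \<open>m = 0\<close> for the finite sums of \<open>x\<close>, and \<open>m = k - 1\<close> for
    the telescoped products.\<close>
  have quot1: "sum z F / z m \<in> C" if "finite F" "F \<noteq> {}" "m < Min F" for F m
    using quotC[of "{m}" F] that by simp
  define x where "x n = z n / z 0" for n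
  define y where "y n = z n / z (n - 1)" for n
  have sumx: "sum x F = sum z F / z 0" for F
    by (simp add: x_def sum_divide_distrib)
  have "FS x \<subseteq> C"
  proof -
    have "sum x F \<in> C" if "F \<in> Pf" for F
    proof -
      have F: "finite F" "F \<noteq> {}" "F \<subseteq> {1..}"
        using that by (auto simp: Pf_def)
      \<comment> \<open>Index 0 lies outside every set in \<open>Pf\<close>, which leaves
        \<open>z 0\<close> free to be the common denominator.\<close>
      then have "0 < Min F"
        by (auto simp: Suc_le_eq)
      with F show ?thesis
        unfolding sumx by (intro quot1)
    qed
    then show ?thesis by (auto simp: FS_def)
  qed
  moreover have "{sum x G / sum x F | F G. F \<in> Pf \<and> G \<in> Pf \<and> set_less F G} \<subseteq> C"
  proof clarify
    fix F G assume FG: "F \<in> Pf" "G \<in> Pf" "set_less F G"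
    have "sum x G / sum x F = sum z G / sum z F"
      using nz[of 0] by (simp add: sumx)
    then show "sum x G / sum x F \<in> C"
      using quotC[of F G] FG by (simp add: Pf_def set_less_def)
  qed
  moreover have "{\<Sum>l\<in>F. \<Prod>n=k..l. y n | F k. F \<in> Pf \<and> 1 \<le> k \<and> k \<le> Min F} \<subseteq> C"
  proof clarify
    fix F k assume Fk: "F \<in> Pf" "1 \<le> k" "k \<le> Min F"
    have F: "finite F" "F \<noteq> {}"
      using Fk by (auto simp: Pf_def)
    have "(\<Sum>l\<in>F. \<Prod>n=k..l. y n) = (\<Sum>l\<in>F. z l / z (k - 1))"
    proof (rule sum.cong)
      fix l assume "l \<in> F"
      then have "k \<le> l"
        using F Fk(3) by simp
      then show "(\<Prod>n=k..l. y n) = z l / z (k - 1)"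
        unfolding y_def by (rule prod_consecutive_quotients[OF nz Fk(2)])
    qed simp
    also have "\<dots> = sum z F / z (k - 1)"
      by (simp add: sum_divide_distrib)
    also have "\<dots> \<in> C"
    proof (rule quot1[OF F])
      show "k - 1 < Min F"
        using Fk(2,3) by linarith
    qed
    finally show "(\<Sum>l\<in>F. \<Prod>n=k..l. y n) \<in> C" .
  qed
  moreover have "\<forall>n\<ge>1. x n > 0" "\<forall>n\<ge>1. y n > 0"
    using pos by (simp_all add: x_def y_def)
  ultimately show ?thesis
    by (intro exI[of _ x] exI[of _ y] conjI Un_least)
qed

end
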